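(* Let $f\in\mathbb{F}[X]$ be a polynomial computed by an interval formula $F$ of size $s$ and depth $d$. Then $f$ can also be computed by an interval formula of size $\mathrm{poly}(s)$ and depth $O(\log s)$.
   Context: $X=\{x_1,\ldots,x_n\}$; for $i<j$, $X_{ij}=\{x_p: i\le p\le j\}$. An arithmetic formula is a tree-shaped circuit with $+,\times$ gates and leaves labeled by variables or field constants; size is the number of gates and depth the length of the longest root-to-leaf path. An interval formula is an arithmetic formula such that for every gate $g$ there is an interval $[i,j]$, $i<j$, with $g$ computing a polynomial in $X_{ij}$, and for every product gate $g=h_1\times h_2$ the intervals corresponding to $h_1$ and $h_2$ are non-overlapping; the interval of a sum gate with inputs on intervals $I_1,I_2$ is $I_1\cup I_2$. *)

theory Defs
  imports Complex_Main "HOL-Library.Poly_Mapping" "HOL-Library.Landau_Symbols"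
begin

text \<open>Multivariate polynomials are finitely supported functions from monomials to
  coefficients, a monomial being a finitely supported map from variable indices to exponents;
  the convolution product of \<^theory>\<open>HOL-Library.Poly_Mapping\<close> is polynomial multiplication.\<close>

type_synonym 'a mpolynomial = "(nat \<Rightarrow>\<^sub>0 nat) \<Rightarrow>\<^sub>0 'a"

definition indets :: "'a::zero mpolynomial \<Rightarrow> nat set" where
  "indets p = (\<Union>m\<in>Poly_Mapping.keys p. Poly_Mapping.keys m)"

definition polys_in :: "nat set \<Rightarrow> 'a::zero mpolynomial set" where
  "polys_in V = {p. indets p \<subseteq> V}"

datatype 'a aformula =
    Var nat
  | Const 'a
  | Add "'a aformula" "'a aformula"
  | Mul "'a aformula" "'a aformula"

fun computes :: "'a::comm_ring_1 aformula \<Rightarrow> 'a mpolynomial" where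
  "computes (Var k) = Poly_Mapping.single (Poly_Mapping.single k 1) 1"
| "computes (Const c) = Poly_Mapping.single 0 c"
| "computes (Add g h) = computes g + computes h"
| "computes (Mul g h) = computes g * computes h"

text \<open>Leaves are not counted as gates.\<close>

fun num_gates :: "'a aformula \<Rightarrow> nat" where
  "num_gates (Var k) = 0"
| "num_gates (Const c) = 0"
| "num_gates (Add g h) = Suc (num_gates g + num_gates h)"
| "num_gates (Mul g h) = Suc (num_gates g + num_gates h)"

fun formula_depth :: "'a aformula \<Rightarrow> nat" where
  "formula_depth (Var k) = 0"
| "formula_depth (Const c) = 0"
| "formula_depth (Add g h) = Suc (max (formula_depth g) (formula_depth h))"
| "formula_depth (Mul g h) = Suc (max (formula_depth g) (formula_depth h))"

text \<open>\<open>on_interval n g i j\<close>: intervals \<open>[i', j']\<close> with \<open>1 \<le> i' < j' \<le> n\<close> can be chosen for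
  all nodes of \<open>g\<close>, leaves included, such that all conditions on interval formulas hold and
  the root gets \<open>[i, j]\<close>. The interval of a node may be any one whose variables contain those
  of the polynomial computed there (so a leaf \<open>x\<^sub>k\<close> can take any \<open>[i, j]\<close> with
  \<open>i \<le> k \<le> j\<close>, a constant any interval), except that at a sum node it is forced to be the
  union of the intervals of the inputs, which must therefore be an interval again.\<close>

inductive on_interval :: "nat \<Rightarrow> 'a::comm_ring_1 aformula \<Rightarrow> nat \<Rightarrow> nat \<Rightarrow> bool" for n where
  var: "\<lbrakk>1 \<le> i; i < j; j \<le> n; computes (Var k :: 'a aformula) \<in> polys_in {i..j}\<rbrakk>
    \<Longrightarrow> on_interval n (Var k) i j"
| const: "\<lbrakk>1 \<le> i; i < j; j \<le> n; computes (Const c) \<in> polys_in {i..j}\<rbrakk>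
    \<Longrightarrow> on_interval n (Const c) i j"
| add: "\<lbrakk>1 \<le> i; i < j; j \<le> n; computes (Add g h) \<in> polys_in {i..j};
      on_interval n g i1 j1; on_interval n h i2 j2; {i..j} = {i1..j1} \<union> {i2..j2}\<rbrakk>
    \<Longrightarrow> on_interval n (Add g h) i j"
| mul: "\<lbrakk>1 \<le> i; i < j; j \<le> n; computes (Mul g h) \<in> polys_in {i..j};
      on_interval n g i1 j1; on_interval n h i2 j2; {i1..j1} \<inter> {i2..j2} = {}\<rbrakk>
    \<Longrightarrow> on_interval n (Mul g h) i j"

definition interval_formula :: "nat \<Rightarrow> 'a::comm_ring_1 aformula \<Rightarrow> bool" where
  "interval_formula n g \<longleftrightarrow> (\<exists>i j. on_interval n g i j)"

end

theory Submission imports Defs "HOL-Library.Log_Nat" begin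

text \<open>Replacing by 0 the variables that do not occur in the polynomial of a product gate's input
  makes the input formula itself avoid them. After this the siblings at the product gates above a
  subformula \<open>v\<close> lie entirely to the left or entirely to the right of \<open>v\<close>, so the formula computes
  \<open>p \<cdot> v \<cdot> q + b\<close>, where \<open>p\<close> and \<open>q\<close> are the products of the siblings on the two sides and
  \<open>(p \<cdot> v) \<cdot> q\<close> is again an admissible order of multiplication. Choosing \<open>v\<close> with at least
  \<open>2 ^ k\<close> gates and inputs with fewer, in a formula with fewer than \<open>2 ^ (k + 1)\<close> gates, leaves
  only parts with fewer than \<open>2 ^ k\<close> gates, as in Brent's depth reduction. The size bound
  then follows from the depth bound.\<close>

section \<open>Variables of sums and products of polynomials\<close>

lemma keys_plus_nat: "Poly_Mapping.keys (a + b) = Poly_Mapping.keys a \<union> Poly_Mapping.keys b"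
  for a b :: "'b \<Rightarrow>\<^sub>0 nat"
  by (auto simp: in_keys_iff lookup_add)

lemma polys_in_iff: "p \<in> polys_in V \<longleftrightarrow> (\<forall>a\<in>Poly_Mapping.keys p. Poly_Mapping.keys a \<subseteq> V)"
  by (auto simp: polys_in_def indets_def)

lemma polys_in_mono: "p \<in> polys_in V \<Longrightarrow> V \<subseteq> W \<Longrightarrow> p \<in> polys_in W"
  by (auto simp: polys_in_def)

lemma polys_in_add:
  fixes p q :: "'a::comm_ring_1 mpolynomial"
  shows "p \<in> polys_in V \<Longrightarrow> q \<in> polys_in V \<Longrightarrow> p + q \<in> polys_in V"
  using Poly_Mapping.keys_add[of p q] by (auto simp: polys_in_iff)

lemma polys_in_diff:
  fixes p q :: "'a::comm_ring_1 mpolynomial"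
  shows "p \<in> polys_in V \<Longrightarrow> q \<in> polys_in V \<Longrightarrow> p - q \<in> polys_in V"
  using Poly_Mapping.keys_diff[of p q] by (auto simp: polys_in_iff)

lemma polys_in_mult:
  fixes p q :: "'a::comm_ring_1 mpolynomial"
  assumes "p \<in> polys_in V" "q \<in> polys_in V"
  shows "p * q \<in> polys_in V"
  unfolding polys_in_iff
proof
  fix a assume "a \<in> Poly_Mapping.keys (p * q)"
  then obtain b c where "a = b + c" "b \<in> Poly_Mapping.keys p" "c \<in> Poly_Mapping.keys q"
    using Poly_Mapping.keys_mult[of p q] by blast
  then show "Poly_Mapping.keys a \<subseteq> V"
    using assms unfolding polys_in_iff by (metis keys_plus_nat Un_least)
qed

lemma computes_Const_polys_in: "computes (Const c) \<in> polys_in V"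
  by (simp add: polys_in_iff)

section \<open>Congruence modulo variables\<close>

text \<open>Equality modulo the ideal generated by the variables outside \<open>V\<close>.\<close>

definition cong_on :: "nat set \<Rightarrow> 'a::comm_ring_1 mpolynomial \<Rightarrow> 'a mpolynomial \<Rightarrow> bool" where
  "cong_on V p q \<longleftrightarrow> (\<forall>a\<in>Poly_Mapping.keys (p - q). \<not> Poly_Mapping.keys a \<subseteq> V)"

lemma cong_on_refl [simp]: "cong_on V p p"
  by (simp add: cong_on_def)

lemma cong_on_trans:
  assumes "cong_on V p q" "cong_on V q r"
  shows "cong_on V p r"
  using assms Poly_Mapping.keys_add[of "p - q" "q - r"] unfolding cong_on_def by auto

lemma cong_on_add:
  assumes "cong_on V p p'" "cong_on V q q'"
  shows "cong_on V (p + q) (p' + q')"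
proof (rule cong_on_trans)
  show "cong_on V (p + q) (p' + q)" "cong_on V (p' + q) (p' + q')"
    using assms by (auto simp: cong_on_def)
qed

lemma cong_on_mult_right:
  assumes "cong_on V p p'"
  shows "cong_on V (p * q) (p' * q)"
  unfolding cong_on_def
proof
  fix a assume "a \<in> Poly_Mapping.keys (p * q - p' * q)"
  then obtain b c where "a = b + c" "b \<in> Poly_Mapping.keys (p - p')"
    using Poly_Mapping.keys_mult[of "p - p'" q] unfolding left_diff_distrib[symmetric] by blast
  then show "\<not> Poly_Mapping.keys a \<subseteq> V"
    using assms unfolding cong_on_def by (metis keys_plus_nat le_sup_iff)
qed

lemma cong_on_mult:
  assumes "cong_on V p p'" "cong_on V q q'"
  shows "cong_on V (p * q) (p' * q')"
  using cong_on_mult_right[OF assms(1), of q] cong_on_mult_right[OF assms(2), of p']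
  by (metis cong_on_trans mult.commute)

text \<open>Monomials of \<open>p - q\<close> use only variables of \<open>W\<close>, so one that
  leaves \<open>V \<inter> W\<close> leaves \<open>V\<close>. This carries a congruence obtained on
  one side of a cut back to \<open>V\<close>.\<close>

lemma cong_on_Int:
  assumes "cong_on (V \<inter> W) p q" "p \<in> polys_in W" "q \<in> polys_in W"
  shows "cong_on V p q"
  using assms polys_in_diff[OF assms(2,3)] unfolding cong_on_def polys_in_iff by blast

lemma cong_on_polys_in_eq:
  assumes "cong_on V p q" "p \<in> polys_in V" "q \<in> polys_in V"
  shows "p = q"
proof -
  have "Poly_Mapping.keys (p - q) = {}"
    using assms polys_in_diff[OF assms(2,3)] unfolding cong_on_def polys_in_iff by blast
  then show ?thesis by simp
qed

section \<open>Formulas with product gates ordered by cuts\<close>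

text \<open>The two sides of a valid cut \<open>m\<close> are the intervals \<open>[1, m]\<close> and \<open>[m + 1, n]\<close>, which
  must have at least two elements each.\<close>

definition valid_cut :: "nat \<Rightarrow> nat \<Rightarrow> bool" where
  "valid_cut n m \<longleftrightarrow> 2 \<le> m \<and> m + 2 \<le> n"

text \<open>Variables are tested at the leaves, not in the computed polynomials, so \<open>V\<close>
  excludes even variables that would cancel. \<open>V\<close> need not be an interval: one cut per
  product gate, with the left side as first input, replaces the choice of intervals.\<close>

fun cut_formula :: "nat \<Rightarrow> nat set \<Rightarrow> 'a aformula \<Rightarrow> bool" where
  "cut_formula n V (Var k) \<longleftrightarrow> k \<in> V"
| "cut_formula n V (Const c) \<longleftrightarrow> True"
| "cut_formula n V (Add g h) \<longleftrightarrow> cut_formula n V g \<and> cut_formula n V h"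
| "cut_formula n V (Mul g h) \<longleftrightarrow>
     (\<exists>m. valid_cut n m \<and> cut_formula n (V \<inter> {..m}) g \<and> cut_formula n (V \<inter> {m<..}) h)"

lemma cut_formula_mono: "cut_formula n V F \<Longrightarrow> V \<subseteq> W \<Longrightarrow> cut_formula n W F"
proof (induction F arbitrary: V W)
  case (Mul g h)
  then obtain m where m: "valid_cut n m" "cut_formula n (V \<inter> {..m}) g"
    "cut_formula n (V \<inter> {m<..}) h" by auto
  have "V \<inter> {..m} \<subseteq> W \<inter> {..m}" "V \<inter> {m<..} \<subseteq> W \<inter> {m<..}" using Mul.prems(2) by auto
  then show ?case using m Mul.IH by (metis cut_formula.simps(4))
qed auto

lemma cut_formula_MulI:
  assumes "valid_cut n m" "cut_formula n A g" "cut_formula n B h"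
    "A \<subseteq> V \<inter> {..m}" "B \<subseteq> V \<inter> {m<..}"
  shows "cut_formula n V (Mul g h)"
  using assms cut_formula_mono[of n A g "V \<inter> {..m}"] cut_formula_mono[of n B h "V \<inter> {m<..}"]
  by auto

lemma cut_formula_polys_in:
  "cut_formula n V F \<Longrightarrow> computes F \<in> polys_in V" for F :: "'a::comm_ring_1 aformula"
proof (induction F arbitrary: V)
  case (Mul g h)
  then obtain m where "computes g \<in> polys_in (V \<inter> {..m})" "computes h \<in> polys_in (V \<inter> {m<..})"
    by auto
  then show ?case by (auto intro!: polys_in_mult intro: polys_in_mono)
qed (auto simp: polys_in_add, auto simp: polys_in_iff)

section \<open>Passage between interval formulas and cuts\<close>

lemma on_interval_polys_in: "on_interval n F i j \<Longrightarrow> computes F \<in> polys_in {i..j}"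
  by (erule on_interval.cases) auto

lemma on_interval_bounds: "on_interval n F i j \<Longrightarrow> 1 \<le> i \<and> i < j \<and> j \<le> n"
  by (erule on_interval.cases) auto

text \<open>Putting 0 for the variables outside \<open>V\<close> respects sums and products, and it
  turns leaves into leaves. \<open>V\<close> is arbitrary in the induction because an input of a
  product gate may contain variables beyond its interval that are absent from its polynomial; it
  must therefore be restricted to its side of a cut.\<close>

lemma on_interval_imp_restricted_cut_formula:
  fixes F :: "'a::comm_ring_1 aformula"
  assumes "on_interval n F i j"
  shows "\<exists>G. cut_formula n V G \<and> num_gates G = num_gates F \<and> cong_on V (computes G) (computes F)"
  using assms
proof (induction arbitrary: V rule: on_interval.induct)
  case (var i j k)
  show ?case
  proof (cases "k \<in> V")
    case True
    then show ?thesis by (intro exI[of _ "Var k"]) auto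
  next
    case False
    then show ?thesis by (intro exI[of _ "Const 0"]) (auto simp: cong_on_def)
  qed
next
  case (const i j c)
  show ?case by (intro exI[of _ "Const c"]) auto
next
  case (add i j g h i1 j1 i2 j2)
  from add.IH(1)[of V] add.IH(2)[of V] obtain G H where
    "cut_formula n V G" "num_gates G = num_gates g" "cong_on V (computes G) (computes g)"
    "cut_formula n V H" "num_gates H = num_gates h" "cong_on V (computes H) (computes h)"
    by auto
  then show ?case by (intro exI[of _ "Add G H"]) (auto intro: cong_on_add)
next
  case (mul i j g h i1 j1 i2 j2)
  \<comment> \<open>The case of \<open>g\<close> to the left of \<open>h\<close>, for arbitrary
    \<open>g\<close> and \<open>h\<close>, so that commutativity settles the other order too. The
    cut is the right end \<open>j1\<close> of the left interval.\<close>
  have *: "\<exists>G. cut_formula n V G \<and> num_gates G = Suc (num_gates g + num_gates h) \<and>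
      cong_on V (computes G) (computes g * computes h)"
    if lt: "j1 < i2" and bds: "1 \<le> i1" "i1 < j1" "i2 < j2" "j2 \<le> n"
      and pg: "computes g \<in> polys_in {i1..j1}" and ph: "computes h \<in> polys_in {i2..j2}"
      and IHg: "\<And>V. \<exists>G. cut_formula n V G \<and> num_gates G = num_gates g \<and>
        cong_on V (computes G) (computes g)"
      and IHh: "\<And>V. \<exists>G. cut_formula n V G \<and> num_gates G = num_gates h \<and>
        cong_on V (computes G) (computes h)"
    for g h :: "'a aformula" and i1 j1 i2 j2
  proof -
    from IHg[of "V \<inter> {..j1}"] IHh[of "V \<inter> {j1<..}"] obtain G H where
      G: "cut_formula n (V \<inter> {..j1}) G" "num_gates G = num_gates g"
        "cong_on (V \<inter> {..j1}) (computes G) (computes g)" and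
      H: "cut_formula n (V \<inter> {j1<..}) H" "num_gates H = num_gates h"
        "cong_on (V \<inter> {j1<..}) (computes H) (computes h)"
      by auto
    have "cong_on V (computes G) (computes g)"
      using G(3) by (rule cong_on_Int)
        (use cut_formula_polys_in[OF G(1)] pg in \<open>auto intro: polys_in_mono\<close>)
    moreover have "cong_on V (computes H) (computes h)"
      using H(3) by (rule cong_on_Int)
        (use cut_formula_polys_in[OF H(1)] ph lt in \<open>auto elim!: polys_in_mono\<close>)
    \<comment> \<open>Both intervals have at least two elements, hence so do both sides of the
      cut.\<close>
    moreover have "valid_cut n j1" using lt bds by (auto simp: valid_cut_def)
    ultimately show ?thesis
      using G H by (intro exI[of _ "Mul G H"]) (auto intro: cong_on_mult)
  qed
  note bds = on_interval_bounds[OF mul.hyps(5)] on_interval_bounds[OF mul.hyps(6)]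
  have "i1 \<notin> {i2..j2}" "i2 \<notin> {i1..j1}" using mul.hyps(7) bds by auto
  then consider "j1 < i2" | "j2 < i1" using bds by force
  then show ?case
  proof cases
    case 1
    show ?thesis
      using *[OF 1 _ _ _ _ on_interval_polys_in[OF mul.hyps(5)] on_interval_polys_in[OF mul.hyps(6)]
          mul.IH] bds by simp
  next
    case 2
    show ?thesis
      using *[OF 2 _ _ _ _ on_interval_polys_in[OF mul.hyps(6)] on_interval_polys_in[OF mul.hyps(5)]
          mul.IH(2,1)] bds by (simp add: add.commute mult.commute)
  qed
qed

text \<open>Inputs of a sum gate inherit \<open>[i, j]\<close>. Inputs of a product gate take the
  whole sides \<open>[1, m]\<close> and \<open>[m + 1, n]\<close>, even if these reach beyond
  \<open>[i, j]\<close>: the interval of a product only has to contain the variables of its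
  polynomial.\<close>

lemma cut_formula_imp_on_interval:
  fixes F :: "'a::comm_ring_1 aformula"
  assumes "cut_formula n V F" "V \<subseteq> {i..j}" "1 \<le> i" "i < j" "j \<le> n"
  shows "on_interval n F i j"
  using assms
proof (induction F arbitrary: V i j)
  case (Var k)
  then show ?case by (auto intro!: on_interval.var simp: polys_in_iff)
next
  case (Const c)
  then show ?case by (intro on_interval.const computes_Const_polys_in)
next
  case (Add g h)
  have "computes (Add g h) \<in> polys_in {i..j}"
    using cut_formula_polys_in[OF Add.prems(1)] Add.prems(2) by (rule polys_in_mono)
  then show ?case
    using Add by (intro on_interval.add[where ?i1.0 = i and ?j1.0 = j and ?i2.0 = i and ?j2.0 = j]) auto
next
  case (Mul g h)
  obtain m where m: "valid_cut n m" "cut_formula n (V \<inter> {..m}) g" "cut_formula n (V \<inter> {m<..}) h"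
    using Mul.prems(1) by auto
  have "on_interval n g 1 m" using m(2)
    by (rule Mul.IH(1)) (use m(1) Mul.prems in \<open>auto simp: valid_cut_def\<close>)
  moreover have "on_interval n h (Suc m) n" using m(3)
    by (rule Mul.IH(2)) (use m(1) Mul.prems in \<open>auto simp: valid_cut_def\<close>)
  moreover have "computes (Mul g h) \<in> polys_in {i..j}"
    using cut_formula_polys_in[OF Mul.prems(1)] Mul.prems(2) by (rule polys_in_mono)
  ultimately show ?case using Mul.prems by (intro on_interval.mul) auto
qed

section \<open>Splitting at a subformula and balancing\<close>

text \<open>A subformula \<open>v\<close> on variables \<open>T\<close> contributes to the whole formula as
  \<open>p \<cdot> v \<cdot> q\<close>, with \<open>p\<close> and \<open>q\<close> the products of its siblings to the left and to the right.
  An empty product is not represented by the formula \<open>Const 1\<close>, since no valid cut need be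
  available to multiply with it.\<close>

definition left_factor ::
  "nat \<Rightarrow> nat \<Rightarrow> nat set \<Rightarrow> nat set \<Rightarrow> 'a::comm_ring_1 mpolynomial \<Rightarrow> bool" where
  "left_factor n b A T p \<longleftrightarrow> p = 1 \<and> A = {} \<or>
     (\<exists>m P. valid_cut n m \<and> A \<subseteq> {..m} \<and> T \<subseteq> {m<..} \<and>
        cut_formula n A P \<and> computes P = p \<and> num_gates P \<le> b)"

definition right_factor ::
  "nat \<Rightarrow> nat \<Rightarrow> nat set \<Rightarrow> nat set \<Rightarrow> 'a::comm_ring_1 mpolynomial \<Rightarrow> bool" where
  "right_factor n b T C q \<longleftrightarrow> q = 1 \<and> C = {} \<or>
     (\<exists>m Q. valid_cut n m \<and> T \<subseteq> {..m} \<and> C \<subseteq> {m<..} \<and>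
        cut_formula n C Q \<and> computes Q = q \<and> num_gates Q \<le> b)"

lemma left_factor_mono: "left_factor n b A T p \<Longrightarrow> b \<le> b' \<Longrightarrow> left_factor n b' A T p"
  unfolding left_factor_def using order_trans by blast

lemma right_factor_mono: "right_factor n b T C q \<Longrightarrow> b \<le> b' \<Longrightarrow> right_factor n b' T C q"
  unfolding right_factor_def using order_trans by blast

text \<open>For passing a product gate whose left input contains the subformula: \<open>h\<close>
  lies beyond the siblings collected so far and is multiplied on at the right end.\<close>

lemma right_factor_extend:
  assumes q: "right_factor n b T C q" and m: "valid_cut n m"
    and T: "T \<subseteq> {..m}" and C: "C \<subseteq> {..m}"
    and h: "cut_formula n H h" "H \<subseteq> {m<..}"
  shows "right_factor n (Suc (b + num_gates h)) T (C \<union> H) (q * computes h)"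
  using q unfolding right_factor_def
proof (elim disjE conjE exE)
  assume "q = 1" "C = {}"
  then show "q * computes h = 1 \<and> C \<union> H = {} \<or> (\<exists>m Q. valid_cut n m \<and> T \<subseteq> {..m} \<and>
      C \<union> H \<subseteq> {m<..} \<and> cut_formula n (C \<union> H) Q \<and> computes Q = q * computes h \<and>
      num_gates Q \<le> Suc (b + num_gates h))"
    using m T h by (intro disjI2 exI[of _ m] exI[of _ h]) auto
next
  fix k Q
  assume Q: "valid_cut n k" "T \<subseteq> {..k}" "C \<subseteq> {k<..}" "cut_formula n C Q" "computes Q = q"
    "num_gates Q \<le> b"
  have "cut_formula n (C \<union> H) (Mul Q h)"
    using m Q(4) h(1) by (rule cut_formula_MulI) (use C h(2) in auto)
  \<comment> \<open>\<open>T\<close> lies below both cuts, while \<open>C\<close> is only known to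
    lie above \<open>k\<close> and \<open>H\<close> above \<open>m\<close>; the smaller cut
    separates \<open>T\<close> from both.\<close>
  moreover have "valid_cut n (min k m)" using m Q(1) by (auto simp: min_def)
  ultimately show "q * computes h = 1 \<and> C \<union> H = {} \<or> (\<exists>m Q. valid_cut n m \<and> T \<subseteq> {..m} \<and>
      C \<union> H \<subseteq> {m<..} \<and> cut_formula n (C \<union> H) Q \<and> computes Q = q * computes h \<and>
      num_gates Q \<le> Suc (b + num_gates h))"
    using Q T C h by (intro disjI2 exI[of _ "min k m"] exI[of _ "Mul Q h"]) (auto simp: min_def)
qed

text \<open>The mirror image, for a subformula in the right input: \<open>g\<close> becomes the
  leftmost factor.\<close>

lemma left_factor_extend:
  assumes p: "left_factor n b A T p" and m: "valid_cut n m"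
    and T: "T \<subseteq> {m<..}" and A: "A \<subseteq> {m<..}"
    and g: "cut_formula n G g" "G \<subseteq> {..m}"
  shows "left_factor n (Suc (num_gates g + b)) (G \<union> A) T (computes g * p)"
  using p unfolding left_factor_def
proof (elim disjE conjE exE)
  assume "p = 1" "A = {}"
  then show "computes g * p = 1 \<and> G \<union> A = {} \<or> (\<exists>m P. valid_cut n m \<and> G \<union> A \<subseteq> {..m} \<and>
      T \<subseteq> {m<..} \<and> cut_formula n (G \<union> A) P \<and> computes P = computes g * p \<and>
      num_gates P \<le> Suc (num_gates g + b))"
    using m T g by (intro disjI2 exI[of _ m] exI[of _ g]) auto
next
  fix k P
  assume P: "valid_cut n k" "A \<subseteq> {..k}" "T \<subseteq> {k<..}" "cut_formula n A P" "computes P = p"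
    "num_gates P \<le> b"
  have "cut_formula n (G \<union> A) (Mul g P)"
    using m g(1) P(4) by (rule cut_formula_MulI) (use A g(2) in auto)
  moreover have "valid_cut n (max k m)" using m P(1) by (auto simp: max_def)
  ultimately show "computes g * p = 1 \<and> G \<union> A = {} \<or> (\<exists>m P. valid_cut n m \<and> G \<union> A \<subseteq> {..m} \<and>
      T \<subseteq> {m<..} \<and> cut_formula n (G \<union> A) P \<and> computes P = computes g * p \<and>
      num_gates P \<le> Suc (num_gates g + b))"
    using P T A g by (intro disjI2 exI[of _ "max k m"] exI[of _ "Mul g P"]) (auto simp: max_def)
qed

text \<open>A new left sibling on \<open>G\<close> enlarges the block that \<open>q\<close> has to
  stay to the right of. As \<open>C\<close> lies above \<open>m\<close>, the old cut may be raised
  to at least \<open>m\<close>.\<close>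

lemma right_factor_extend_left:
  assumes q: "right_factor n b T C q" and m: "valid_cut n m" and C: "C \<subseteq> {m<..}" and G: "G \<subseteq> {..m}"
  shows "right_factor n b (G \<union> T) C q"
  using q unfolding right_factor_def
proof (elim disjE conjE exE)
  assume "q = 1" "C = {}"
  then show "q = 1 \<and> C = {} \<or> (\<exists>m Q. valid_cut n m \<and> G \<union> T \<subseteq> {..m} \<and> C \<subseteq> {m<..} \<and>
      cut_formula n C Q \<and> computes Q = q \<and> num_gates Q \<le> b)" by simp
next
  fix k Q
  assume Q: "valid_cut n k" "T \<subseteq> {..k}" "C \<subseteq> {k<..}" "cut_formula n C Q" "computes Q = q"
    "num_gates Q \<le> b"
  moreover have "valid_cut n (max k m)" using m Q(1) by (auto simp: max_def)
  ultimately show "q = 1 \<and> C = {} \<or> (\<exists>m Q. valid_cut n m \<and> G \<union> T \<subseteq> {..m} \<and> C \<subseteq> {m<..} \<and>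
      cut_formula n C Q \<and> computes Q = q \<and> num_gates Q \<le> b)"
    using C G by (intro disjI2 exI[of _ "max k m"] exI[of _ Q]) (auto simp: max_def)
qed

text \<open>\<open>p * v\<close> is formed first, so \<open>q\<close> is placed relative to
  \<open>A \<union> T\<close>. The number \<open>b\<close> bounds each of the factors and
  \<open>B\<close> separately, not their sum, so siblings may be duplicated; \<open>t\<close> is the
  threshold at which the descent to \<open>v\<close> stops.\<close>

definition splits ::
  "nat \<Rightarrow> nat \<Rightarrow> nat set \<Rightarrow> nat \<Rightarrow> 'a::comm_ring_1 mpolynomial \<Rightarrow> bool" where
  "splits n t V b f \<longleftrightarrow> (\<exists>A T C p v1 v2 v q B.
     f = p * computes v * q + computes B \<and> A \<subseteq> V \<and> T \<subseteq> V \<and> C \<subseteq> V \<and>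
     left_factor n b A T p \<and> right_factor n b (A \<union> T) C q \<and>
     cut_formula n V B \<and> num_gates B \<le> b \<and>
     cut_formula n T v \<and> (v = Add v1 v2 \<or> v = Mul v1 v2) \<and> num_gates v1 < t \<and> num_gates v2 < t)"

lemma splits_self:
  assumes "cut_formula n V v" "v = Add v1 v2 \<or> v = Mul v1 v2" "num_gates v1 < t" "num_gates v2 < t"
  shows "splits n t V b (computes v)"
  unfolding splits_def
  by (rule exI[of _ "{}"], rule exI[of _ V], rule exI[of _ "{}"], rule exI[of _ 1],
      rule exI[of _ v1], rule exI[of _ v2], rule exI[of _ v], rule exI[of _ 1],
      rule exI[of _ "Const 0"]) (use assms in \<open>auto simp: left_factor_def right_factor_def\<close>)

lemma splits_add:
  assumes "splits n t V b f" "cut_formula n V h"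
  shows "splits n t V (Suc (b + num_gates h)) (f + computes h)"
proof -
  from assms(1) obtain A T C p v1 v2 v q B where
    f: "f = p * computes v * q + computes B" and sub: "A \<subseteq> V" "T \<subseteq> V" "C \<subseteq> V" and
    p: "left_factor n b A T p" and q: "right_factor n b (A \<union> T) C q" and
    B: "cut_formula n V B" "num_gates B \<le> b" and
    v: "cut_formula n T v" "v = Add v1 v2 \<or> v = Mul v1 v2" "num_gates v1 < t" "num_gates v2 < t"
    unfolding splits_def by blast
  have "f + computes h = p * computes v * q + computes (Add B h)" using f by simp
  moreover have "left_factor n (Suc (b + num_gates h)) A T p"
    using p by (rule left_factor_mono) simp
  moreover have "right_factor n (Suc (b + num_gates h)) (A \<union> T) C q"
    using q by (rule right_factor_mono) simp
  moreover have "cut_formula n V (Add B h)" "num_gates (Add B h) \<le> Suc (b + num_gates h)"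
    using B assms(2) by auto
  ultimately show ?thesis using sub v unfolding splits_def by blast
qed

text \<open>Distributivity puts one copy of \<open>h\<close> into the right factor and another into
  \<open>B\<close>.\<close>

lemma splits_mult_right:
  assumes "splits n t (V \<inter> {..m}) b f" "cut_formula n (V \<inter> {m<..}) h" "valid_cut n m"
  shows "splits n t V (Suc (b + num_gates h)) (f * computes h)"
proof -
  from assms(1) obtain A T C p v1 v2 v q B where
    f: "f = p * computes v * q + computes B" and
    sub: "A \<subseteq> V \<inter> {..m}" "T \<subseteq> V \<inter> {..m}" "C \<subseteq> V \<inter> {..m}" and
    p: "left_factor n b A T p" and q: "right_factor n b (A \<union> T) C q" and
    B: "cut_formula n (V \<inter> {..m}) B" "num_gates B \<le> b" and
    v: "cut_formula n T v" "v = Add v1 v2 \<or> v = Mul v1 v2" "num_gates v1 < t" "num_gates v2 < t"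
    unfolding splits_def by blast
  have "f * computes h = p * computes v * (q * computes h) + computes (Mul B h)"
    using f by (simp add: algebra_simps)
  moreover have "left_factor n (Suc (b + num_gates h)) A T p"
    using p by (rule left_factor_mono) simp
  moreover have "right_factor n (Suc (b + num_gates h)) (A \<union> T) (C \<union> (V \<inter> {m<..})) (q * computes h)"
    using q assms(3) _ _ assms(2) by (rule right_factor_extend) (use sub in auto)
  moreover have "cut_formula n V (Mul B h)" "num_gates (Mul B h) \<le> Suc (b + num_gates h)"
    using B assms(2,3) by auto
  moreover have "A \<subseteq> V" "T \<subseteq> V" "C \<union> (V \<inter> {m<..}) \<subseteq> V" using sub by auto
  ultimately show ?thesis using v unfolding splits_def by blast
qed

lemma splits_mult_left:
  assumes "splits n t (V \<inter> {m<..}) b f" "cut_formula n (V \<inter> {..m}) g" "valid_cut n m"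
  shows "splits n t V (Suc (num_gates g + b)) (computes g * f)"
proof -
  from assms(1) obtain A T C p v1 v2 v q B where
    f: "f = p * computes v * q + computes B" and
    sub: "A \<subseteq> V \<inter> {m<..}" "T \<subseteq> V \<inter> {m<..}" "C \<subseteq> V \<inter> {m<..}" and
    p: "left_factor n b A T p" and q: "right_factor n b (A \<union> T) C q" and
    B: "cut_formula n (V \<inter> {m<..}) B" "num_gates B \<le> b" and
    v: "cut_formula n T v" "v = Add v1 v2 \<or> v = Mul v1 v2" "num_gates v1 < t" "num_gates v2 < t"
    unfolding splits_def by blast
  have "computes g * f = (computes g * p) * computes v * q + computes (Mul g B)"
    using f by (simp add: algebra_simps)
  moreover have "left_factor n (Suc (num_gates g + b)) ((V \<inter> {..m}) \<union> A) T (computes g * p)"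
    using p assms(3) _ _ assms(2) by (rule left_factor_extend) (use sub in auto)
  moreover have "right_factor n (Suc (num_gates g + b)) (((V \<inter> {..m}) \<union> A) \<union> T) C q"
    unfolding Un_assoc
    by (rule right_factor_mono[OF right_factor_extend_left[OF q assms(3)]]) (use sub in auto)
  moreover have "cut_formula n V (Mul g B)" "num_gates (Mul g B) \<le> Suc (num_gates g + b)"
    using B assms(2,3) by auto
  moreover have "(V \<inter> {..m}) \<union> A \<subseteq> V" "T \<subseteq> V" "C \<subseteq> V" using sub by auto
  ultimately show ?thesis using v unfolding splits_def by blast
qed

text \<open>Descend into an input with at least \<open>t\<close> gates while there is one. Each
  factor and \<open>B\<close> uses every gate outside the final \<open>v\<close> at most once, and
  \<open>v\<close> has at least \<open>t\<close> gates.\<close>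

lemma cut_formula_splits:
  assumes "cut_formula n V F" "t \<le> num_gates F" "0 < t"
  shows "splits n t V (num_gates F - t) (computes F)"
  using assms
proof (induction F arbitrary: V)
  case (Add g h)
  consider "t \<le> num_gates g" | "t \<le> num_gates h" | "num_gates g < t" "num_gates h < t"
    by linarith
  then show ?case
  proof cases
    case 1
    then show ?thesis
      using Add splits_add[of n t V "num_gates g - t" "computes g" h] by (simp add: Suc_diff_le)
  next
    case 2
    then show ?thesis
      using Add splits_add[of n t V "num_gates h - t" "computes h" g]
      by (simp add: Suc_diff_le add.commute)
  next
    case 3
    with Add.prems(1) show ?thesis
      using splits_self[of n V "Add g h" g h t] by auto
  qed
next
  case (Mul g h)
  from Mul.prems obtain m where m: "valid_cut n m" "cut_formula n (V \<inter> {..m}) g"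
    "cut_formula n (V \<inter> {m<..}) h" by auto
  consider "t \<le> num_gates g" | "t \<le> num_gates h" | "num_gates g < t" "num_gates h < t"
    by linarith
  then show ?case
  proof cases
    case 1
    then show ?thesis
      using splits_mult_right[OF Mul.IH(1)[OF m(2)] m(3,1)] Mul.prems by (simp add: Suc_diff_le)
  next
    case 2
    then show ?thesis
      using splits_mult_left[OF Mul.IH(2)[OF m(3)] m(2,1)] Mul.prems by (simp add: Suc_diff_le)
  next
    case 3
    with Mul.prems(1) show ?thesis
      using splits_self[of n V "Mul g h" g h t] by auto
  qed
qed auto

text \<open>With threshold \<open>2 ^ k\<close>, the factors, \<open>B\<close> and the two inputs of
  \<open>v\<close> all have fewer than \<open>2 ^ k\<close> gates, hence depth at most
  \<open>4 * k\<close> after balancing. Four levels are added: the gate of \<open>v\<close>, the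
  products with \<open>p\<close> and \<open>q\<close>, and the sum with \<open>B\<close>.\<close>

lemma cut_formula_balance:
  assumes "cut_formula n V F" "num_gates F < 2 ^ k"
  shows "\<exists>G. cut_formula n V G \<and> computes G = computes F \<and> formula_depth G \<le> 4 * k"
  using assms
proof (induction k arbitrary: V F)
  case 0
  then show ?case by (intro exI[of _ F]) (cases F, auto)
next
  case (Suc k)
  show ?case
  proof (cases "num_gates F < 2 ^ k")
    case True
    then show ?thesis using Suc.IH[OF Suc.prems(1)] by fastforce
  next
    case False
    then have "splits n (2 ^ k) V (num_gates F - 2 ^ k) (computes F)"
      using Suc.prems(1) by (intro cut_formula_splits) auto
    then obtain A T C p v1 v2 v q B where
      F: "computes F = p * computes v * q + computes B" and sub: "A \<subseteq> V" "T \<subseteq> V" "C \<subseteq> V" and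
      p: "left_factor n (num_gates F - 2 ^ k) A T p" and
      q: "right_factor n (num_gates F - 2 ^ k) (A \<union> T) C q" and
      B: "cut_formula n V B" "num_gates B \<le> num_gates F - 2 ^ k" and
      v: "cut_formula n T v" "v = Add v1 v2 \<or> v = Mul v1 v2"
        "num_gates v1 < 2 ^ k" "num_gates v2 < 2 ^ k"
      unfolding splits_def by blast
    have small: "num_gates F - 2 ^ k < 2 ^ k" using Suc.prems(2) by simp
    obtain B' where B': "cut_formula n V B'" "computes B' = computes B" "formula_depth B' \<le> 4 * k"
      using Suc.IH[OF B(1)] B(2) small by fastforce
    obtain v' where v': "cut_formula n T v'" "computes v' = computes v" "formula_depth v' \<le> 4 * k + 1"
      using v(2)
    proof
      assume "v = Add v1 v2"
      then obtain w1 w2 where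
        "cut_formula n T w1" "computes w1 = computes v1" "formula_depth w1 \<le> 4 * k"
        "cut_formula n T w2" "computes w2 = computes v2" "formula_depth w2 \<le> 4 * k"
        using v Suc.IH[of T v1] Suc.IH[of T v2] by auto
      with \<open>v = Add v1 v2\<close> show thesis by (intro that[of "Add w1 w2"]) auto
    next
      assume veq: "v = Mul v1 v2"
      then obtain m where m: "valid_cut n m" "cut_formula n (T \<inter> {..m}) v1"
        "cut_formula n (T \<inter> {m<..}) v2" using v by auto
      then obtain w1 w2 where
        "cut_formula n (T \<inter> {..m}) w1" "computes w1 = computes v1" "formula_depth w1 \<le> 4 * k"
        "cut_formula n (T \<inter> {m<..}) w2" "computes w2 = computes v2" "formula_depth w2 \<le> 4 * k"
        using v Suc.IH[OF m(2)] Suc.IH[OF m(3)] by auto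
      with veq m(1) show thesis by (intro that[of "Mul w1 w2"]) auto
    qed
    obtain P where P: "cut_formula n (A \<union> T) P" "computes P = p * computes v"
      "formula_depth P \<le> 4 * k + 2"
      using p unfolding left_factor_def
    proof (elim disjE conjE exE)
      assume "p = 1" "A = {}"
      with v' show thesis by (intro that[of v']) auto
    next
      fix m R
      assume R: "valid_cut n m" "A \<subseteq> {..m}" "T \<subseteq> {m<..}" "cut_formula n A R" "computes R = p"
        "num_gates R \<le> num_gates F - 2 ^ k"
      obtain R' where R': "cut_formula n A R'" "computes R' = computes R" "formula_depth R' \<le> 4 * k"
        using Suc.IH[OF R(4)] R(6) small by fastforce
      have "cut_formula n (A \<union> T) (Mul R' v')"
        using R(1) R'(1) v'(1) by (rule cut_formula_MulI) (use R in auto)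
      with R R' v' show thesis by (intro that[of "Mul R' v'"]) auto
    qed
    obtain Q where Q: "cut_formula n V Q" "computes Q = p * computes v * q"
      "formula_depth Q \<le> 4 * k + 3"
      using q unfolding right_factor_def
    proof (elim disjE conjE exE)
      assume "q = 1" "C = {}"
      with P sub show thesis by (intro that[of P]) (auto intro: cut_formula_mono)
    next
      fix m R
      assume R: "valid_cut n m" "A \<union> T \<subseteq> {..m}" "C \<subseteq> {m<..}" "cut_formula n C R" "computes R = q"
        "num_gates R \<le> num_gates F - 2 ^ k"
      obtain R' where R': "cut_formula n C R'" "computes R' = computes R" "formula_depth R' \<le> 4 * k"
        using Suc.IH[OF R(4)] R(6) small by fastforce
      have "cut_formula n V (Mul P R')"
        using R(1) P(1) R'(1) by (rule cut_formula_MulI) (use R sub in auto)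
      with R R' P show thesis by (intro that[of "Mul P R'"]) auto
    qed
    show ?thesis
      using Q B' F by (intro exI[of _ "Add Q B'"]) auto
  qed
qed

section \<open>Size from depth, and growth bounds\<close>

lemma num_gates_less_power_depth: "num_gates F < 2 ^ formula_depth F"
proof -
  \<comment> \<open>The two strict inequalities leave room for the root gate.\<close>
  have "Suc (a + b) < 2 ^ Suc (max c d)" if "a < 2 ^ c" "b < 2 ^ d" for a b c d :: nat
  proof -
    have "a < 2 ^ max c d" using that(1) by (rule less_le_trans) (simp add: power_increasing)
    moreover have "b < 2 ^ max c d" using that(2) by (rule less_le_trans) (simp add: power_increasing)
    ultimately show ?thesis by simp
  qed
  then show ?thesis by (induction F) auto
qed

text \<open>Restricting to the root interval changes the polynomial only modulo variables outside
  it, and neither polynomial contains such variables, so the two are equal.\<close>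

lemma interval_formula_balance:
  assumes "interval_formula n F" "num_gates F < 2 ^ k"
  shows "\<exists>G. interval_formula n G \<and> computes G = computes F \<and> formula_depth G \<le> 4 * k"
proof -
  from assms(1) obtain i j where ij: "on_interval n F i j" unfolding interval_formula_def by blast
  obtain H where H: "cut_formula n {i..j} H" "num_gates H = num_gates F"
    "cong_on {i..j} (computes H) (computes F)"
    using on_interval_imp_restricted_cut_formula[OF ij] by blast
  have eq: "computes H = computes F"
    using H(3) cut_formula_polys_in[OF H(1)] on_interval_polys_in[OF ij]
    by (rule cong_on_polys_in_eq)
  obtain G where G: "cut_formula n {i..j} G" "computes G = computes H" "formula_depth G \<le> 4 * k"
    using cut_formula_balance[OF H(1)] H(2) assms(2) by auto
  have "on_interval n G i j"
    using G(1) by (rule cut_formula_imp_on_interval) (use on_interval_bounds[OF ij] in auto)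
  with G eq show ?thesis unfolding interval_formula_def by auto
qed

lemma less_two_power_floorlog: "s < 2 ^ floorlog 2 s"
  \<comment> \<open>\<open>floorlog 2 s\<close> is the number of binary digits of \<open>s\<close>,
    and it is 0 for \<open>s = 0\<close>, where the claim reads \<open>0 < 1\<close>.\<close>
  using floorlog_bounds[of s 2] by (cases "s = 0") auto

lemma two_power_floorlog_le: "0 < s \<Longrightarrow> 2 ^ floorlog 2 s \<le> 2 * s"
  using floorlog_bounds[of s 2] power_Suc[of "2::nat" "floorlog 2 s - 1"]
  by (cases "floorlog 2 s") auto

theorem mainTheorem14:
  "\<exists>S D :: nat \<Rightarrow> nat.
     (\<exists>k. (\<lambda>s. real (S s)) \<in> O(\<lambda>s. real s ^ k)) \<and>
     (\<lambda>s. real (D s)) \<in> O(\<lambda>s. ln (real s)) \<and>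
     (\<forall>n s d (f :: 'a::field mpolynomial) F.
        f \<in> polys_in {1..n} \<longrightarrow>
        interval_formula n F \<longrightarrow> computes F = f \<longrightarrow>
        num_gates F = s \<longrightarrow> formula_depth F = d \<longrightarrow>
        (\<exists>F'. interval_formula n F' \<and> computes F' = f \<and>
              num_gates F' \<le> S s \<and> formula_depth F' \<le> D s))"
proof -
  \<comment> \<open>The depth bound of the balancing with \<open>k = floorlog 2 s\<close>; the size
    bound will be \<open>2 ^ D s\<close>.\<close>
  define D :: "nat \<Rightarrow> nat" where "D s = 4 * floorlog 2 s" for s
  have S: "(\<lambda>s. real (2 ^ D s)) \<in> O(\<lambda>s. real s ^ 4)"
  \<comment> \<open>From \<open>2 ^ floorlog 2 s \<le> 2 * s\<close>, the fourth power is at most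
    \<open>16 * s ^ 4\<close>.\<close>
  proof (rule bigoI[of _ 16], rule eventually_mono[OF eventually_gt_at_top[of 0]])
    fix s :: nat assume "0 < s"
    then have "(2 ^ floorlog 2 s) ^ 4 \<le> (2 * s) ^ 4"
      by (intro power_mono two_power_floorlog_le) auto
    then have "2 ^ D s \<le> 16 * s ^ 4"
      by (simp add: D_def power_mult_distrib mult.commute flip: power_mult)
    then have "real (2 ^ D s) \<le> real (16 * s ^ 4)" by (rule of_nat_mono)
    then show "norm (real (2 ^ D s)) \<le> 16 * norm (real s ^ 4)" by simp
  qed
  have D: "(\<lambda>s. real (D s)) \<in> O(\<lambda>s. ln (real s))"
  \<comment> \<open>For \<open>s \<ge> 2\<close> we have \<open>2 * s \<le> s * s\<close>, so
    \<open>floorlog 2 s\<close> is at most \<open>2 / ln 2\<close> times \<open>ln s\<close>; the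
    factor 4 in \<open>D\<close> gives 8. Starting at 2 avoids \<open>ln 1 = 0\<close>.\<close>
  proof (rule bigoI[of _ "8 / ln 2"], rule eventually_mono[OF eventually_ge_at_top[of 2]])
    fix s :: nat assume s: "2 \<le> s"
    then have "real (2 ^ floorlog 2 s) \<le> real (s * s)"
      using two_power_floorlog_le[of s] mult_le_mono1[of 2 s s] by (intro of_nat_mono) linarith
    then have "ln (2 ^ floorlog 2 s) \<le> ln (real s * real s)"
      using s by (intro ln_mono) auto
    then have "real (floorlog 2 s) * ln 2 \<le> 2 * ln (real s)"
      using s by (simp add: ln_realpow ln_mult)
    then show "norm (real (D s)) \<le> 8 / ln 2 * norm (ln (real s))"
      using s by (simp add: D_def field_simps)
  qed
  have "\<exists>G. interval_formula n G \<and> computes G = computes F \<and>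
      num_gates G \<le> 2 ^ D (num_gates F) \<and> formula_depth G \<le> D (num_gates F)"
    if F: "interval_formula n F" for n and F :: "'a aformula"
  proof -
    obtain G where G: "interval_formula n G" "computes G = computes F"
      "formula_depth G \<le> D (num_gates F)"
      using interval_formula_balance[OF F less_two_power_floorlog] by (auto simp: D_def)
    have "num_gates G \<le> 2 ^ formula_depth G" using num_gates_less_power_depth[of G] by simp
    also have "\<dots> \<le> 2 ^ D (num_gates F)" using G(3) by (intro power_increasing) auto
    finally show ?thesis using G by blast
  qed
  with S D show ?thesis by (intro exI[of _ "\<lambda>s. 2 ^ D s"] exI[of _ D]) auto
qed

end
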